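(* Let $V$ be a real separable Hilbert space and let $a,b,m$ be symmetric bilinear forms on $V$ such that $a$ is continuous and $V$-coercive, $b$ is weakly continuous, and $m$ is weakly continuous with $m(u,u)>0$ for all nonzero $u\in V$. Let $\lambda\in\mathbb{R}$ be fixed. If $e_1,e_2$ are eigenvectors of $(a,b,m)$ corresponding to distinct eigenpoints $(\lambda,\mu_1)$ and $(\lambda,\mu_2)$ in $\sigma(a,b,m)$, respectively, then $$m(e_1,e_2)=0\qquad\text{and}\qquad a(e_1,e_2)-\lambda\,b(e_1,e_2)=0.$$
   Context: "$a$ is continuous and $V$-coercive" means there are constants $0<\kappa_1\le\kappa_2<\infty$ with $\kappa_1\|u\|^2\le a(u,u)\le\kappa_2\|u\|^2$ for all $u\in V$. A symmetric bilinear form $b$ on $V$ is weakly continuous if $u_j\rightharpoonup u$ and $v_j\rightharpoonup v$ weakly in $V$ imply $b(u_j,v_j)\to b(u,v)$. A pair $(\lambda,\mu)\in\mathbb{R}^2$ is an eigenpoint of $(a,b,m)$ if there is a nonzero $u\in V$ (an eigenvector corresponding to $(\lambda,\mu)$) with $a(u,v)=\lambda\,b(u,v)+\mu\,m(u,v)$ for all $v\in V$; $\sigma(a,b,m)\subset\mathbb{R}^2$ is the set of all eigenpoints. *)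

theory Defs
  imports "HOL-Analysis.Analysis"
begin

text \<open>
  A real Hilbert space is rendered as a type of sort
  \<open>{real_inner, complete_space}\<close>.
\<close>

definition symmetric_bilinear_form :: "('v::real_vector \<Rightarrow> 'v \<Rightarrow> real) \<Rightarrow> bool" where
  "symmetric_bilinear_form f \<longleftrightarrow> bilinear f \<and> (\<forall>u v. f u v = f v u)"

definition continuous_coercive :: "('v::real_normed_vector \<Rightarrow> 'v \<Rightarrow> real) \<Rightarrow> bool" where
  "continuous_coercive a \<longleftrightarrow>
    (\<exists>\<kappa>\<^sub>1 \<kappa>\<^sub>2. 0 < \<kappa>\<^sub>1 \<and> \<kappa>\<^sub>1 \<le> \<kappa>\<^sub>2 \<and>
      (\<forall>u. \<kappa>\<^sub>1 * (norm u)\<^sup>2 \<le> a u u \<and> a u u \<le> \<kappa>\<^sub>2 * (norm u)\<^sup>2))"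

text \<open>Weak convergence is tested against all continuous linear functionals.\<close>

definition weakly_converges :: "(nat \<Rightarrow> 'v::real_normed_vector) \<Rightarrow> 'v \<Rightarrow> bool" where
  "weakly_converges x l \<longleftrightarrow>
    (\<forall>\<phi> :: 'v \<Rightarrow> real. bounded_linear \<phi> \<longrightarrow> (\<lambda>j. \<phi> (x j)) \<longlonglongrightarrow> \<phi> l)"

definition weakly_continuous_form :: "('v::real_normed_vector \<Rightarrow> 'v \<Rightarrow> real) \<Rightarrow> bool" where
  "weakly_continuous_form b \<longleftrightarrow>
    (\<forall>x y u v. weakly_converges x u \<longrightarrow> weakly_converges y v \<longrightarrow>
      (\<lambda>j. b (x j) (y j)) \<longlonglongrightarrow> b u v)"

definition eigenvector ::
    "('v::real_vector \<Rightarrow> 'v \<Rightarrow> real) \<Rightarrow> ('v \<Rightarrow> 'v \<Rightarrow> real) \<Rightarrow> ('v \<Rightarrow> 'v \<Rightarrow> real) \<Rightarrow>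
      real \<times> real \<Rightarrow> 'v \<Rightarrow> bool" where
  "eigenvector a b m p u \<longleftrightarrow>
    u \<noteq> 0 \<and> (\<forall>v. a u v = fst p * b u v + snd p * m u v)"

definition eigenpoints ::
    "('v::real_vector \<Rightarrow> 'v \<Rightarrow> real) \<Rightarrow> ('v \<Rightarrow> 'v \<Rightarrow> real) \<Rightarrow> ('v \<Rightarrow> 'v \<Rightarrow> real) \<Rightarrow>
      (real \<times> real) set" where
  "eigenpoints a b m = {p. \<exists>u. eigenvector a b m p u}"

end

theory Submission
  imports Defs
begin

text \<open>
  With \<open>lam\<close> fixed, the equation says that \<open>e\<^sub>1\<close> and \<open>e\<^sub>2\<close> are eigenvectors of the symmetric form
  \<open>c = a - lam * b\<close> relative to \<open>m\<close>, with eigenvalues \<open>\<mu>\<^sub>1 \<noteq> \<mu>\<^sub>2\<close>. As for a symmetric matrix,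
  evaluating \<open>c e\<^sub>1 e\<^sub>2\<close> with either vector as the eigenvector gives
  \<open>\<mu>\<^sub>1 * m e\<^sub>1 e\<^sub>2 = \<mu>\<^sub>2 * m e\<^sub>1 e\<^sub>2\<close>, so \<open>m e\<^sub>1 e\<^sub>2\<close> vanishes, and with it \<open>c e\<^sub>1 e\<^sub>2\<close>.
\<close>

theorem corollary5p3:
  fixes a b m :: "'v::{real_inner, complete_space} \<Rightarrow> 'v \<Rightarrow> real"
    and lam \<mu>\<^sub>1 \<mu>\<^sub>2 :: real
    and e\<^sub>1 e\<^sub>2 :: 'v
  assumes "separable_space (euclidean :: 'v topology)"
    and "symmetric_bilinear_form a"
    and "symmetric_bilinear_form b"
    and "symmetric_bilinear_form m"
    and "continuous_coercive a"
    and "weakly_continuous_form b"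
    and "weakly_continuous_form m"
    and "\<And>u. u \<noteq> 0 \<Longrightarrow> m u u > 0"
    and "(lam, \<mu>\<^sub>1) \<in> eigenpoints a b m"
    and "(lam, \<mu>\<^sub>2) \<in> eigenpoints a b m"
    and "(lam, \<mu>\<^sub>1) \<noteq> (lam, \<mu>\<^sub>2)"
    and "eigenvector a b m (lam, \<mu>\<^sub>1) e\<^sub>1"
    and "eigenvector a b m (lam, \<mu>\<^sub>2) e\<^sub>2"
  shows "m e\<^sub>1 e\<^sub>2 = 0 \<and> a e\<^sub>1 e\<^sub>2 - lam * b e\<^sub>1 e\<^sub>2 = 0"
proof -
  have c1: "a e\<^sub>1 e\<^sub>2 - lam * b e\<^sub>1 e\<^sub>2 = \<mu>\<^sub>1 * m e\<^sub>1 e\<^sub>2"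
    using assms(12) by (simp add: eigenvector_def)
  have "a e\<^sub>2 e\<^sub>1 - lam * b e\<^sub>2 e\<^sub>1 = \<mu>\<^sub>2 * m e\<^sub>2 e\<^sub>1"
    using assms(13) by (simp add: eigenvector_def)
  moreover have "a e\<^sub>2 e\<^sub>1 = a e\<^sub>1 e\<^sub>2" "b e\<^sub>2 e\<^sub>1 = b e\<^sub>1 e\<^sub>2" "m e\<^sub>2 e\<^sub>1 = m e\<^sub>1 e\<^sub>2"
    using assms(2-4) unfolding symmetric_bilinear_form_def by blast+
  ultimately have "\<mu>\<^sub>1 * m e\<^sub>1 e\<^sub>2 = \<mu>\<^sub>2 * m e\<^sub>1 e\<^sub>2"
    using c1 by simp
  then have "m e\<^sub>1 e\<^sub>2 = 0"
    using assms(11) by simp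
  then show ?thesis
    using c1 by simp
qed

end
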